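(* Let $E,F$ be Banach spaces over the same field $\mathbb K\in\{\mathbb R,\mathbb C\}$, let $U\subseteq E$ be open, let $f\colon U\to F$ and let $x\in U$. Then $f$ is Carathéodory differentiable at $x$ if and only if $f$ is Fréchet differentiable at $x$. Moreover, in that case the two notions of derivative coincide: if $\Phi_x$ is a slope function of $f$ at $x$, then $A:=\Phi_x(x)$ is a Fréchet derivative of $f$ at $x$; and if $A$ is a Fréchet derivative of $f$ at $x$, then there exists a slope function $\Phi_x$ of $f$ at $x$ with $\Phi_x(x)=A$.
   Context: $\mathcal L(E,F)$ denotes the space of bounded ($\mathbb K$-)linear operators from $E$ to $F$ with the operator norm. Carathéodory differentiability: $f\colon U\to F$ is Carathéodory differentiable at $x\in U$ if there exists a map $\Phi_x\colon U\to\mathcal L(E,F)$, continuous at $x$ (with respect to the operator norm), such that $f(y)=f(x)+\Phi_x(y)(y-x)$ for all $y\in U$. Such a $\Phi_x$ is called a slope function of $f$ at $x$, and $\Phi_x(x)\in\mathcal L(E,F)$ is called the derivative of $f$ at $x$. Fréchet differentiability: $f\colon U\to F$ is Fréchet differentiable at $x\in U$ with Fréchet derivative $A\in\mathcal L(E,F)$ if $\lim_{y\to x}\frac{f(y)-f(x)-A(y-x)}{\|y-x\|}=0$ in $F$. *)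

theory Defs
  imports "HOL-Analysis.Analysis"
begin

text \<open>
  The scalar fields \<open>\<real>\<close> and \<open>\<complex>\<close>, up to isometric isomorphism of real algebras. The real field appears
  as the set of real numbers within the complex numbers.
\<close>

class real_or_complex = real_normed_field +
  assumes real_or_complex:
    "\<exists>h :: 'a \<Rightarrow> complex.
       (\<forall>a b. h (a + b) = h a + h b) \<and> (\<forall>a b. h (a * b) = h a * h b) \<and>
       (\<forall>r a. h (scaleR r a) = scaleR r (h a)) \<and> (\<forall>a. norm (h a) = norm a) \<and>
       inj h \<and> (range h = \<real> \<or> range h = UNIV)"

instance real :: real_or_complex
  by standard
    (rule exI[of _ complex_of_real],
      simp add: inj_of_real scaleR_conv_of_real Reals_def)

instance complex :: real_or_complex
  by standard (rule exI[of _ "\<lambda>a. a"], simp)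

text \<open>
  The library's normed spaces carry a real scalar multiplication only. A normed space over
  \<open>'k\<close> is such a space with a scalar multiplication by \<open>'k\<close> that extends the real one and for
  which the norm is homogeneous; it is a Banach space over \<open>'k\<close> if \<open>'e\<close> is of class
  \<open>banach\<close>. For \<open>'k = real\<close> the scalar multiplication is necessarily \<open>scaleR\<close>.
\<close>

locale normed_space_over = vector_space scale
  for scale :: "'k::real_or_complex \<Rightarrow> 'e::real_normed_vector \<Rightarrow> 'e" +
  assumes scale_of_real: "scale (of_real r) v = r *\<^sub>R v"
    and norm_scale: "norm (scale c v) = norm c * norm v"

lemma normed_space_over_scaleR:
  "normed_space_over (scaleR :: real \<Rightarrow> 'e::real_normed_vector \<Rightarrow> 'e)"
  by unfold_locales (simp_all add: scaleR_add_right scaleR_add_left)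

lemma normed_space_over_mult:
  "normed_space_over ((*) :: 'k::real_or_complex \<Rightarrow> 'k \<Rightarrow> 'k)"
  by unfold_locales (simp_all add: algebra_simps scaleR_conv_of_real norm_mult)

text \<open>
  The operator norm of a \<open>'k\<close>-linear operator does not depend on whether it is regarded as
  linear over \<open>'k\<close> or over the reals, so the bounded \<open>'k\<close>-linear operators form a subset
  of the library's type of bounded real-linear operators, with the same norm.
\<close>

definition bounded_operators ::
    "('k::real_or_complex \<Rightarrow> 'e \<Rightarrow> 'e) \<Rightarrow> ('k \<Rightarrow> 'f \<Rightarrow> 'f) \<Rightarrow>
      ('e::real_normed_vector \<Rightarrow>\<^sub>L 'f::real_normed_vector) set" where
  "bounded_operators sE sF = {A. Vector_Spaces.linear sE sF (blinfun_apply A)}"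

text \<open>
  A map on \<open>U\<close> is represented by a total function; the definitions below use only its
  values on \<open>U\<close>.
\<close>

definition slope_function ::
    "('k::real_or_complex \<Rightarrow> 'e \<Rightarrow> 'e) \<Rightarrow> ('k \<Rightarrow> 'f \<Rightarrow> 'f) \<Rightarrow> 'e set \<Rightarrow> ('e \<Rightarrow> 'f) \<Rightarrow> 'e \<Rightarrow>
      ('e::real_normed_vector \<Rightarrow> ('e \<Rightarrow>\<^sub>L 'f::real_normed_vector)) \<Rightarrow> bool" where
  "slope_function sE sF U f x \<Phi> \<longleftrightarrow>
     (\<forall>y\<in>U. \<Phi> y \<in> bounded_operators sE sF) \<and>
     continuous (at x within U) \<Phi> \<and>
     (\<forall>y\<in>U. f y = f x + blinfun_apply (\<Phi> y) (y - x))"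

definition caratheodory_differentiable ::
    "('k::real_or_complex \<Rightarrow> 'e \<Rightarrow> 'e) \<Rightarrow> ('k \<Rightarrow> 'f \<Rightarrow> 'f) \<Rightarrow> 'e set \<Rightarrow>
      ('e::real_normed_vector \<Rightarrow> 'f::real_normed_vector) \<Rightarrow> 'e \<Rightarrow> bool" where
  "caratheodory_differentiable sE sF U f x \<longleftrightarrow> (\<exists>\<Phi>. slope_function sE sF U f x \<Phi>)"

definition has_frechet_derivative ::
    "('k::real_or_complex \<Rightarrow> 'e \<Rightarrow> 'e) \<Rightarrow> ('k \<Rightarrow> 'f \<Rightarrow> 'f) \<Rightarrow> 'e set \<Rightarrow>
      ('e::real_normed_vector \<Rightarrow> 'f::real_normed_vector) \<Rightarrow> 'e \<Rightarrow> ('e \<Rightarrow>\<^sub>L 'f) \<Rightarrow> bool" where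
  "has_frechet_derivative sE sF U f x A \<longleftrightarrow>
     A \<in> bounded_operators sE sF \<and> (f has_derivative blinfun_apply A) (at x within U)"

definition frechet_differentiable ::
    "('k::real_or_complex \<Rightarrow> 'e \<Rightarrow> 'e) \<Rightarrow> ('k \<Rightarrow> 'f \<Rightarrow> 'f) \<Rightarrow> 'e set \<Rightarrow>
      ('e::real_normed_vector \<Rightarrow> 'f::real_normed_vector) \<Rightarrow> 'e \<Rightarrow> bool" where
  "frechet_differentiable sE sF U f x \<longleftrightarrow> (\<exists>A. has_frechet_derivative sE sF U f x A)"

end

theory Submission
  imports Defs
begin

text \<open>
  A slope function turns into a Frechet derivative by the estimate
  \<open>\<parallel>(\<Phi> y - \<Phi> x) (y - x)\<parallel> \<le> \<parallel>\<Phi> y - \<Phi> x\<parallel> \<parallel>y - x\<parallel>\<close>: the remainder of the first-order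
  expansion with derivative \<open>\<Phi> x\<close> is exactly the left-hand side.

  Conversely, let \<open>A\<close> be a Frechet derivative and \<open>r y = f y - f x - A (y - x)\<close>. A slope
  function with value \<open>A\<close> at \<open>x\<close> is \<open>A + T y\<close>, where the operator \<open>T y\<close> has to map \<open>y - x\<close> to
  \<open>r y\<close>. Among all such operators, a small one is needed: if \<open>T y\<close> has norm at most
  \<open>\<parallel>r y\<parallel> / \<parallel>y - x\<parallel>\<close>, then \<open>T y \<rightarrow> 0\<close> as \<open>y \<rightarrow> x\<close>. Such an operator of rank one exists by the
  Hahn-Banach theorem: take \<open>w \<mapsto> (l w / l (y - x)) r y\<close> for a functional \<open>l\<close> of norm at most \<open>1\<close>
  with \<open>\<bar>l (y - x)\<bar> = \<parallel>y - x\<parallel>\<close> (lemma \<open>rank_one_operator\<close>). The functional \<open>l\<close> is chosen for each \<open>y\<close>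
  separately and may jump as \<open>y\<close> varies; the norm bound alone gives continuity at \<open>x\<close>.

  The Hahn-Banach theorem is proved for the norm, with sublinear functionals on the whole
  space: Zorn's lemma yields a minimal one, and minimality forces linearity. The complex case
  follows from the real one by \<open>l w = g w - \<i> g (\<i> w)\<close>.
\<close>

section \<open>Minimal sublinear functionals\<close>

definition sublinear :: "('a::real_vector \<Rightarrow> real) \<Rightarrow> bool" where
  "sublinear p \<longleftrightarrow> (\<forall>a b. p (a + b) \<le> p a + p b) \<and> (\<forall>t\<ge>0. \<forall>a. p (t *\<^sub>R a) = t * p a)"

lemma sublinear_add: "sublinear p \<Longrightarrow> p (a + b) \<le> p a + p b"
  and sublinear_scaleR: "sublinear p \<Longrightarrow> t \<ge> 0 \<Longrightarrow> p (t *\<^sub>R a) = t * p a"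
  by (auto simp: sublinear_def)

lemma sublinear_0: "sublinear p \<Longrightarrow> p 0 = 0"
  using sublinear_scaleR[of p 0 0] by simp

lemma sublinear_minus: "sublinear p \<Longrightarrow> - p (- a) \<le> p a"
  using sublinear_add[of p a "- a"] sublinear_0[of p] by simp

text \<open>One inequality is enough for homogeneity, as scaling by \<open>t\<close> can be undone.\<close>

lemma sublinearI:
  assumes add: "\<And>a b. p (a + b) \<le> p a + p b"
    and scale: "\<And>t a. t > 0 \<Longrightarrow> p (t *\<^sub>R a) \<le> t * p a"
    and zero: "p 0 = 0"
  shows "sublinear p"
proof -
  have "p (t *\<^sub>R a) = t * p a" if "t \<ge> 0" for t a
  proof (cases "t = 0")
    case True
    then show ?thesis by (simp add: zero)
  next
    case False
    with that have t: "t > 0" by simp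
    have "p a \<le> inverse t * p (t *\<^sub>R a)"
      using scale[of "inverse t" "t *\<^sub>R a"] t by simp
    then have "t * p a \<le> p (t *\<^sub>R a)"
      using t by (simp add: field_simps)
    with scale[OF t, of a] show ?thesis by linarith
  qed
  with add show ?thesis by (simp add: sublinear_def)
qed

lemma sublinear_norm: "sublinear norm"
  by (rule sublinearI) (auto simp: norm_triangle_ineq)

text \<open>
  The infimum of \<open>p (w + t v) - t p v\<close> over \<open>t \<ge> 0\<close> lowers \<open>p\<close> until it is linear along \<open>v\<close>. This
  serves twice: every linear functional below the result takes the value \<open>p v\<close> at \<open>v\<close>, and a
  functional that cannot be lowered in this way is odd.
\<close>

lemma sublinear_lower:
  assumes p: "sublinear p"
  obtains q where "sublinear q" "q \<le> p" "q (- v) \<le> - p v"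
proof -
  define k where "k w t = p (w + t *\<^sub>R v) - t * p v" for w t
  define q where "q w = (INF t\<in>{0..}. k w t)" for w
  have lower: "- p (- w) \<le> k w t" if "t \<ge> 0" for w t
    using sublinear_add[OF p, of "w + t *\<^sub>R v" "- w"] sublinear_scaleR[OF p that, of v]
    by (simp add: k_def)
  have q_le: "q w \<le> k w t" if "t \<ge> 0" for w t
    unfolding q_def by (rule cINF_lower) (use that lower in \<open>auto intro!: bdd_belowI2\<close>)
  have q_ge: "c \<le> q w" if "\<And>t. t \<ge> 0 \<Longrightarrow> c \<le> k w t" for c w
    unfolding q_def by (rule cINF_greatest) (use that in auto)
  have "sublinear q"
  proof (rule sublinearI)
    fix a b
    have "q (a + b) \<le> k a s + k b t" if "s \<ge> 0" "t \<ge> 0" for s t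
    proof -
      have "q (a + b) \<le> k (a + b) (s + t)"
        using that by (intro q_le) simp
      also have "\<dots> \<le> k a s + k b t"
        using sublinear_add[OF p, of "a + s *\<^sub>R v" "b + t *\<^sub>R v"]
        by (simp add: k_def algebra_simps)
      finally show ?thesis .
    qed
    then have "q (a + b) - k a s \<le> q b" if "s \<ge> 0" for s
      using that by (intro q_ge) (simp add: algebra_simps)
    then have "q (a + b) - q b \<le> q a"
      by (intro q_ge) (simp add: algebra_simps)
    then show "q (a + b) \<le> q a + q b" by simp
  next
    fix t :: real and a
    assume t: "t > 0"
    have "inverse t * q (t *\<^sub>R a) \<le> k a s" if "s \<ge> 0" for s
    proof -
      have "q (t *\<^sub>R a) \<le> k (t *\<^sub>R a) (t * s)"
        using that t by (intro q_le) simp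
      also have "\<dots> = t * k a s"
        using sublinear_scaleR[OF p, of t "a + s *\<^sub>R v"] t by (simp add: k_def algebra_simps)
      finally show ?thesis using t by (simp add: field_simps)
    qed
    then have "inverse t * q (t *\<^sub>R a) \<le> q a" by (rule q_ge)
    then show "q (t *\<^sub>R a) \<le> t * q a" using t by (simp add: field_simps)
  next
    have "k 0 t = 0" if "t \<ge> 0" for t
      using sublinear_scaleR[OF p that, of v] by (simp add: k_def)
    then show "q 0 = 0"
      using q_le[of 0 0] q_ge[of 0 0] by force
  qed
  moreover have "q \<le> p"
    using q_le[of 0] by (simp add: le_fun_def k_def)
  moreover have "q (- v) \<le> - p v"
    using q_le[of 1 "- v"] sublinear_0[OF p] by (simp add: k_def)
  ultimately show thesis by (rule that)
qed

lemma sublinear_chain_Inf: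
  assumes "C \<noteq> {}" and sub: "\<And>c. c \<in> C \<Longrightarrow> sublinear c" and le: "\<And>c. c \<in> C \<Longrightarrow> c \<le> p"
    and chain: "\<And>c d. c \<in> C \<Longrightarrow> d \<in> C \<Longrightarrow> c \<le> d \<or> d \<le> c"
  obtains q where "sublinear q" "\<And>c. c \<in> C \<Longrightarrow> q \<le> c"
proof -
  define q where "q w = (INF c\<in>C. c w)" for w
  have "- p (- w) \<le> c w" if "c \<in> C" for c w
    using sublinear_minus[OF sub[OF that], of w] le_funD[OF le[OF that], of "- w"]
    by linarith
  then have q_le: "q w \<le> c w" if "c \<in> C" for c w
    unfolding q_def by (intro cINF_lower that bdd_belowI2)
  have q_ge: "m \<le> q w" if "\<And>c. c \<in> C \<Longrightarrow> m \<le> c w" for m w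
    unfolding q_def by (rule cINF_greatest) (use that \<open>C \<noteq> {}\<close> in auto)
  have "sublinear q"
  proof (rule sublinearI)
    fix a b
    have key: "q (a + b) \<le> c a + d b" if c: "c \<in> C" and d: "d \<in> C" for c d
    proof -
      \<comment> \<open>The smaller of the two functionals bounds both terms.\<close>
      obtain e where e: "e \<in> C" "e \<le> c" "e \<le> d"
        using chain[OF c d] c d by blast
      have "q (a + b) \<le> e a + e b"
        using q_le[OF e(1), of "a + b"] sublinear_add[OF sub[OF e(1)], of a b] by linarith
      also have "\<dots> \<le> c a + d b"
        using e by (intro add_mono) (auto simp: le_fun_def)
      finally show ?thesis .
    qed
    have "q (a + b) - c a \<le> q b" if "c \<in> C" for c
      using key[OF that] by (intro q_ge) (simp add: diff_le_eq add.commute)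
    then have "q (a + b) - q b \<le> q a"
      by (intro q_ge) (simp add: algebra_simps)
    then show "q (a + b) \<le> q a + q b" by simp
  next
    fix t :: real and a
    assume t: "t > 0"
    have "inverse t * q (t *\<^sub>R a) \<le> c a" if "c \<in> C" for c
      using q_le[OF that, of "t *\<^sub>R a"] sublinear_scaleR[OF sub[OF that], of t a] t
      by (simp add: field_simps)
    then have "inverse t * q (t *\<^sub>R a) \<le> q a" by (rule q_ge)
    then show "q (t *\<^sub>R a) \<le> t * q a" using t by (simp add: field_simps)
  next
    have "q 0 = (INF c\<in>C. 0)"
      unfolding q_def by (intro INF_cong refl sublinear_0 sub)
    then show "q 0 = 0"
      using \<open>C \<noteq> {}\<close> by simp
  qed
  then show thesis
    using q_le by (intro that) (auto simp: le_fun_def)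
qed

lemma minimal_sublinear_exists:
  assumes "sublinear p"
  obtains g where "sublinear g" "g \<le> p" "\<And>q. sublinear q \<Longrightarrow> q \<le> g \<Longrightarrow> q = g"
proof -
  let ?A = "{q. sublinear q \<and> q \<le> p}"
  let ?P = "\<lambda>a b. b \<le> (a :: 'a \<Rightarrow> real)"
  have "\<exists>m\<in>?A. \<forall>a\<in>?A. ?P m a \<longrightarrow> a = m"
  proof (rule predicate_Zorn)
    show "partial_order_on ?A (relation_of ?P ?A)"
      by (rule partial_order_on_relation_ofI) auto
  next
    fix C assume C: "C \<in> Chains (relation_of ?P ?A)"
    then have sub: "c \<in> ?A" and chain: "c \<le> d \<or> d \<le> c" if "c \<in> C" "d \<in> C" for c d
      using that by (auto simp: Chains_def relation_of_def)
    show "\<exists>u\<in>?A. \<forall>a\<in>C. ?P a u"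
    proof (cases "C = {}")
      case True
      with assms show ?thesis by auto
    next
      case False
      obtain q where q: "sublinear q" "\<And>c. c \<in> C \<Longrightarrow> q \<le> c"
        by (rule sublinear_chain_Inf[OF False, of p]) (use sub chain in auto)
      from False obtain c where "c \<in> C" by blast
      with q(2) sub have "q \<le> c" "c \<le> p" by blast+
      then have "q \<le> p" by (rule order_trans)
      with q show ?thesis by blast
    qed
  qed
  then obtain g where "sublinear g" "g \<le> p"
    and "\<And>q. sublinear q \<Longrightarrow> q \<le> p \<Longrightarrow> q \<le> g \<Longrightarrow> q = g"
    by blast
  then show thesis
    using order_trans[of _ g p] by (intro that[of g]) blast+
qed

text \<open>A minimal sublinear functional cannot be lowered along any \<open>v\<close>, so it is odd. Subadditivity
  at \<open>a, b\<close> and at \<open>- a, - b\<close> then gives the two inequalities of additivity.\<close>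

lemma minimal_sublinear_linear:
  assumes g: "sublinear g" and min: "\<And>q. sublinear q \<Longrightarrow> q \<le> g \<Longrightarrow> q = g"
  shows "linear g"
proof -
  have odd: "g (- v) = - g v" for v
  proof -
    obtain q where "sublinear q" "q \<le> g" "q (- v) \<le> - g v"
      using sublinear_lower[OF g] .
    with min have "g (- v) \<le> - g v" by metis
    with sublinear_minus[OF g, of v] show ?thesis by linarith
  qed
  show ?thesis
  proof (rule linearI)
    fix a b
    show "g (a + b) = g a + g b"
      using sublinear_add[OF g, of a b] sublinear_add[OF g, of "- a" "- b"]
        odd[of a] odd[of b] odd[of "a + b"] by simp
  next
    fix t :: real and a
    show "g (t *\<^sub>R a) = t *\<^sub>R g a"
    proof (cases "t \<ge> 0")
      case True
      then show ?thesis by (simp add: sublinear_scaleR[OF g])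
    next
      case False
      then show ?thesis
        using sublinear_scaleR[OF g, of "- t" a] odd[of "t *\<^sub>R a"] by simp
    qed
  qed
qed

section \<open>Norming functionals\<close>

lemma real_norming_functional:
  fixes v :: "'a::real_normed_vector"
  obtains g :: "'a \<Rightarrow> real" where "linear g" "\<And>w. g w \<le> norm w" "g v = norm v"
proof -
  obtain q where q: "sublinear q" "q \<le> norm" "q (- v) \<le> - norm v"
    using sublinear_lower[OF sublinear_norm] .
  obtain g where g: "sublinear g" "g \<le> q" "\<And>p. sublinear p \<Longrightarrow> p \<le> g \<Longrightarrow> p = g"
    by (rule minimal_sublinear_exists[OF q(1)]) (rule that)
  have lin: "linear g" by (rule minimal_sublinear_linear) (fact g)+
  have le: "g w \<le> norm w" for w
    using le_funD[OF g(2), of w] le_funD[OF q(2), of w] by linarith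
  have "g (- v) \<le> - norm v"
    using le_funD[OF g(2), of "- v"] q(3) by linarith
  with le[of v] have "g v = norm v"
    by (simp add: linear_neg[OF lin])
  with lin le show thesis by (rule that)
qed

text \<open>
  The embedding into \<open>\<complex>\<close> that defines the class is reduced here to a choice of imaginary unit
  inside \<open>'k\<close>. The estimate in the second case says that the real part is at most the modulus.
\<close>

lemma real_or_complex_cases:
  obtains (real) "\<And>c::'k::real_or_complex. \<exists>r. c = of_real r"
  | (complex) j :: "'k::real_or_complex" where "j * j = - 1"
      "\<And>c. \<exists>a b. c = of_real a + j * of_real b"
      "\<And>a b. \<bar>a\<bar> \<le> norm (of_real a + j * of_real b)"
proof -
  obtain h :: "'k \<Rightarrow> complex" where
    add: "\<And>a b. h (a + b) = h a + h b" and mult: "\<And>a b. h (a * b) = h a * h b"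
    and scaleR: "\<And>r a. h (r *\<^sub>R a) = r *\<^sub>R h a" and norm: "\<And>a. norm (h a) = norm a"
    and inj: "inj h" and range: "range h = \<real> \<or> range h = UNIV"
    using real_or_complex by blast
  have "h 1 * h 1 = h 1" using mult[of 1 1] by simp
  moreover have "h 1 \<noteq> 0" using norm[of 1] by auto
  ultimately have one: "h 1 = 1" by simp
  have of_real: "h (of_real r) = of_real r" for r
    by (simp add: of_real_def scaleR one)
  from range show thesis
  proof
    assume R: "range h = \<real>"
    have "\<exists>r. c = of_real r" for c :: 'k
    proof -
      have "h c \<in> \<real>" using R by blast
      then obtain r where "h c = of_real r" by (auto elim: Reals_cases)
      then have "h c = h (of_real r)" by (simp add: of_real)
      then have "c = of_real r" using inj by (simp add: inj_eq)
      then show ?thesis ..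
    qed
    then show thesis by (rule real)
  next
    assume R: "range h = UNIV"
    then obtain j where j: "h j = \<i>" by (metis surjD)
    have h: "h (of_real a + j * of_real b) = Complex a b" for a b
      by (simp add: add mult of_real j Complex_eq)
    have "h (j * j) = h (of_real (- 1))"
      unfolding mult j of_real by simp
    then have "j * j = of_real (- 1)" using inj by (simp only: inj_eq)
    then have jj: "j * j = - 1" by simp
    moreover have "\<exists>a b. c = of_real a + j * of_real b" for c
    proof -
      have "h c = h (of_real (Re (h c)) + j * of_real (Im (h c)))"
        by (simp add: h)
      then show ?thesis using inj by (metis injD)
    qed
    moreover have "\<bar>a\<bar> \<le> norm (of_real a + j * of_real b)" for a b
      using abs_Re_le_cmod[of "Complex a b"] norm[of "of_real a + j * of_real b"]
      by (simp only: h complex.sel)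
    ultimately show thesis by (rule complex)
  qed
qed

lemma linear_over_real:
  assumes "normed_space_over sE" "normed_space_over sF" "Vector_Spaces.linear sE sF T"
  shows "linear T"
proof (rule linearI)
  interpret E: normed_space_over sE by fact
  interpret F: normed_space_over sF by fact
  interpret T: Vector_Spaces.linear sE sF T by fact
  show "T (a + b) = T a + T b" for a b by (rule T.add)
  show "T (r *\<^sub>R a) = r *\<^sub>R T a" for r a
    using T.scale[of "of_real r" a] by (simp add: E.scale_of_real F.scale_of_real)
qed

text \<open>
  Over \<open>\<complex>\<close>, the functional \<open>l w = g w - \<i> g (\<i> w)\<close> has real part \<open>g\<close>. To bound \<open>l w\<close>, rotate \<open>w\<close>
  by a unimodular scalar so that \<open>l w\<close> becomes real and hence equal to a value of \<open>g\<close>.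
\<close>

lemma norming_functional:
  fixes sE :: "'k::real_or_complex \<Rightarrow> 'e::real_normed_vector \<Rightarrow> 'e"
  assumes E: "normed_space_over sE"
  obtains l where "Vector_Spaces.linear sE (*) l" "\<And>w. norm (l w) \<le> norm w"
    "norm (l v) = norm v"
proof -
  interpret E: normed_space_over sE by fact
  have K: "vector_space ((*) :: 'k \<Rightarrow> 'k \<Rightarrow> 'k)"
    using normed_space_over_mult by (rule normed_space_over.axioms)
  obtain g where g: "linear g" "\<And>w. g w \<le> norm w" "g v = norm v"
    by (rule real_norming_functional[of v]) (rule that)
  have g_add: "g (a + b) = g a + g b" and g_scale: "g (r *\<^sub>R a) = r * g a" for a b r
    using linear_add[OF g(1)] linear_scale[OF g(1)] by auto
  have g_abs: "\<bar>g w\<bar> \<le> norm w" for w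
    using g(2)[of w] g(2)[of "- w"] by (simp add: linear_neg[OF g(1)])
  show thesis
  proof (cases rule: real_or_complex_cases[where 'k='k])
    case real
    let ?l = "\<lambda>w. of_real (g w) :: 'k"
    have "?l (sE c w) = c * ?l w" for c w
    proof -
      obtain r where "c = of_real r" using real by blast
      then show ?thesis by (simp add: E.scale_of_real g_scale)
    qed
    then have "Vector_Spaces.linear sE (*) ?l"
      by (simp add: Vector_Spaces.linear_iff E.vector_space_axioms K g_add)
    then show thesis
      by (rule that) (use g_abs g(3) in auto)
  next
    case (complex j)
    define l where "l w = of_real (g w) - j * of_real (g (sE j w))" for w
    have ls: "l (sE c w) = c * l w" for c w
    proof -
      obtain a b where c: "c = of_real a + j * of_real b" using complex(2) by blast
      have jr: "sE (of_real r * j) w = r *\<^sub>R sE j w" for r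
        by (simp only: E.scale_of_real flip: E.scale_scale)
      have "c = of_real a + of_real b * j"
        by (simp add: c)
      then have 1: "sE c w = a *\<^sub>R w + b *\<^sub>R sE j w"
        by (simp only: E.scale_left_distrib E.scale_of_real jr)
      have "j * c = of_real a * j + (j * j) * of_real b"
        by (simp add: c algebra_simps)
      then have "j * c = of_real a * j + of_real (- b)"
        by (simp add: complex(1))
      then have 2: "sE j (sE c w) = a *\<^sub>R sE j w - b *\<^sub>R w"
        by (simp add: E.scale_left_distrib E.scale_of_real jr del: of_real_minus)
      have 3: "g (sE c w) = a * g w + b * g (sE j w)"
        unfolding 1 by (simp add: g_add g_scale)
      have 4: "g (sE j (sE c w)) = a * g (sE j w) - b * g w"
        unfolding 2 by (simp add: linear_diff[OF g(1)] g_scale)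
      have "c * l w = of_real (a * g w) - (j * j) * of_real (b * g (sE j w))
          - j * of_real (a * g (sE j w) - b * g w)"
        by (simp add: l_def c algebra_simps)
      then show ?thesis
        unfolding l_def[of "sE c w"] 3 4 by (simp add: complex(1))
    qed
    have "l (a + b) = l a + l b" for a b
      by (simp add: l_def g_add E.scale_right_distrib algebra_simps)
    with ls have lin: "Vector_Spaces.linear sE (*) l"
      by (simp add: Vector_Spaces.linear_iff E.vector_space_axioms K)
    have re: "\<bar>g w - r\<bar> \<le> norm (l w - of_real r)" for w r
      using complex(3)[of "g w - r" "- g (sE j w)"] by (simp add: l_def algebra_simps)
    have le: "norm (l w) \<le> norm w" for w
    proof (cases "l w = 0")
      case False
      define c where "c = of_real (norm (l w)) / l w"
      have c: "norm c = 1" "l (sE c w) = of_real (norm (l w))"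
        using False by (simp_all add: c_def ls norm_divide)
      have "norm (l w) = g (sE c w)"
        using re[of "sE c w" "norm (l w)"] c(2) by simp
      also have "\<dots> \<le> norm w"
        using g(2)[of "sE c w"] by (simp add: E.norm_scale c(1))
      finally show ?thesis .
    qed simp
    have "norm (l v) = norm v"
      using le[of v] re[of v 0] g(3) by simp
    with lin le show thesis by (rule that)
  qed
qed

text \<open>
  The bound cannot be improved, since any operator that maps \<open>v\<close> to \<open>r\<close> has at least this norm.
  Scaling a norming functional for \<open>v\<close> by \<open>r\<close> attains it.
\<close>

lemma rank_one_operator:
  fixes sE :: "'k::real_or_complex \<Rightarrow> 'e::real_normed_vector \<Rightarrow> 'e"
    and sF :: "'k \<Rightarrow> 'f::real_normed_vector \<Rightarrow> 'f"
  assumes E: "normed_space_over sE" and F: "normed_space_over sF" and v: "v \<noteq> 0"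
  obtains T where "T \<in> bounded_operators sE sF" "blinfun_apply T v = r"
    "norm T \<le> norm r / norm v"
proof -
  interpret E: normed_space_over sE by fact
  interpret F: normed_space_over sF by fact
  obtain l where l: "Vector_Spaces.linear sE (*) l" "\<And>w. norm (l w) \<le> norm w"
    "norm (l v) = norm v"
    by (rule norming_functional[OF E, of v]) (rule that)
  interpret l: Vector_Spaces.linear sE "(*)" l by (rule l)
  have "l v \<noteq> 0" using l(3) v by auto
  define t where "t w = sF (l w / l v) r" for w
  have lin: "Vector_Spaces.linear sE sF t"
    by (simp add: Vector_Spaces.linear_iff E.vector_space_axioms F.vector_space_axioms
        t_def l.add l.scale add_divide_distrib F.scale_left_distrib)
  have bound: "norm (t w) \<le> norm r / norm v * norm w" for w
    using mult_right_mono[OF l(2)[of w], of "norm r / norm v"]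
    by (simp add: t_def F.norm_scale norm_divide l(3) mult_ac)
  have "bounded_linear t"
    using linear_over_real[OF E F lin] bound
    by (intro bounded_linear_intro[of _ "norm r / norm v"])
       (simp_all add: linear_add linear_scale mult.commute)
  then have T: "blinfun_apply (Blinfun t) = t"
    by (rule bounded_linear_Blinfun_apply)
  show thesis
  proof (rule that)
    show "Blinfun t \<in> bounded_operators sE sF"
      using lin by (simp add: bounded_operators_def T)
    show "blinfun_apply (Blinfun t) v = r"
      using \<open>l v \<noteq> 0\<close> by (simp add: T t_def)
    show "norm (Blinfun t) \<le> norm r / norm v"
      using bound by (intro norm_blinfun_bound) (simp_all add: T)
  qed
qed

section \<open>The two notions of derivative\<close>

lemma slope_function_imp_frechet:
  fixes sE :: "'k::real_or_complex \<Rightarrow> 'e::real_normed_vector \<Rightarrow> 'e"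
    and sF :: "'k \<Rightarrow> 'f::real_normed_vector \<Rightarrow> 'f"
  assumes S: "slope_function sE sF U f x \<Phi>" and x: "x \<in> U"
  shows "has_frechet_derivative sE sF U f x (\<Phi> x)"
proof -
  have f: "f y = f x + blinfun_apply (\<Phi> y) (y - x)" if "y \<in> U" for y
    using S that by (auto simp: slope_function_def)
  have "(\<Phi> \<longlongrightarrow> \<Phi> x) (at x within U)"
    using S by (simp add: slope_function_def continuous_within)
  then have lim: "((\<lambda>y. norm (\<Phi> y - \<Phi> x)) \<longlongrightarrow> 0) (at x within U)"
    by (simp add: tendsto_norm_zero LIM_zero)
  have le: "norm ((1 / norm (y - x)) *\<^sub>R (f y - (f x + blinfun_apply (\<Phi> x) (y - x))))
      \<le> norm (\<Phi> y - \<Phi> x)" if "y \<in> U" "y \<noteq> x" for y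
  proof -
    have "f y - (f x + blinfun_apply (\<Phi> x) (y - x)) = blinfun_apply (\<Phi> y - \<Phi> x) (y - x)"
      by (simp add: f[OF that(1)] blinfun.diff_left)
    then show ?thesis
      using norm_blinfun[of "\<Phi> y - \<Phi> x" "y - x"] that by (simp add: divide_le_eq)
  qed
  have "((\<lambda>y. (1 / norm (y - x)) *\<^sub>R (f y - (f x + blinfun_apply (\<Phi> x) (y - x)))) \<longlongrightarrow> 0)
      (at x within U)"
    by (rule Lim_null_comparison[OF _ lim]) (use le in \<open>auto simp: eventually_at_filter\<close>)
  then have "(f has_derivative blinfun_apply (\<Phi> x)) (at x within U)"
    by (simp add: has_derivative_within blinfun.bounded_linear_right)
  then show ?thesis
    using S x by (simp add: has_frechet_derivative_def slope_function_def)
qed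

lemma frechet_imp_slope_function:
  fixes sE :: "'k::real_or_complex \<Rightarrow> 'e::real_normed_vector \<Rightarrow> 'e"
    and sF :: "'k \<Rightarrow> 'f::real_normed_vector \<Rightarrow> 'f"
  assumes E: "normed_space_over sE" and F: "normed_space_over sF"
    and D: "has_frechet_derivative sE sF U f x A"
  obtains \<Phi> where "slope_function sE sF U f x \<Phi>" "\<Phi> x = A"
proof -
  interpret E: normed_space_over sE by fact
  interpret F: normed_space_over sF by fact
  interpret EF: vector_space_pair sE sF ..
  define r where "r y = f y - (f x + blinfun_apply A (y - x))" for y
  have "\<exists>T. y \<noteq> x \<longrightarrow> T \<in> bounded_operators sE sF \<and> blinfun_apply T (y - x) = r y \<and>
      norm T \<le> norm (r y) / norm (y - x)" for y
  proof (cases "y = x")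
    case False
    then have "y - x \<noteq> 0" by simp
    then obtain T where "T \<in> bounded_operators sE sF" "blinfun_apply T (y - x) = r y"
        "norm T \<le> norm (r y) / norm (y - x)"
      by (rule rank_one_operator[OF E F])
    then show ?thesis by blast
  qed simp
  then obtain T where "\<forall>y. y \<noteq> x \<longrightarrow> T y \<in> bounded_operators sE sF \<and>
      blinfun_apply (T y) (y - x) = r y \<and> norm (T y) \<le> norm (r y) / norm (y - x)"
    by metis
  then have T: "T y \<in> bounded_operators sE sF" "blinfun_apply (T y) (y - x) = r y"
      "norm (T y) \<le> norm (r y) / norm (y - x)" if "y \<noteq> x" for y
    using that by simp_all
  define \<Phi> where "\<Phi> y = (if y = x then A else A + T y)" for y
  have A: "A \<in> bounded_operators sE sF"
    using D by (simp add: has_frechet_derivative_def)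
  have "\<Phi> y \<in> bounded_operators sE sF" for y
    using A T(1)[of y] EF.linear_compose_add[of "blinfun_apply A" "blinfun_apply (T y)"]
    by (auto simp: \<Phi>_def bounded_operators_def plus_blinfun.rep_eq)
  moreover have "f y = f x + blinfun_apply (\<Phi> y) (y - x)" for y
    using T(2)[of y] by (simp add: \<Phi>_def r_def blinfun.add_left)
  moreover have "continuous (at x within U) \<Phi>"
  proof -
    have "((\<lambda>y. (1 / norm (y - x)) *\<^sub>R r y) \<longlongrightarrow> 0) (at x within U)"
      using D by (simp add: has_frechet_derivative_def has_derivative_within r_def)
    then have lim: "((\<lambda>y. norm ((1 / norm (y - x)) *\<^sub>R r y)) \<longlongrightarrow> 0) (at x within U)"
      by (rule tendsto_norm_zero)
    have "((\<lambda>y. \<Phi> y - A) \<longlongrightarrow> 0) (at x within U)"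
      by (rule Lim_null_comparison[OF _ lim])
         (use T(3) in \<open>auto simp: eventually_at_filter \<Phi>_def\<close>)
    then have "(\<Phi> \<longlongrightarrow> A) (at x within U)"
      by (rule LIM_zero_cancel)
    then show ?thesis by (simp add: continuous_within \<Phi>_def)
  qed
  ultimately have "slope_function sE sF U f x \<Phi>"
    unfolding slope_function_def by blast
  then show thesis by (rule that) (simp add: \<Phi>_def)
qed

theorem mainTheorem1:
  fixes scaleE :: "'k::real_or_complex \<Rightarrow> 'e::banach \<Rightarrow> 'e"
    and scaleF :: "'k \<Rightarrow> 'f::banach \<Rightarrow> 'f"
    and U :: "'e set" and f :: "'e \<Rightarrow> 'f" and x :: 'e
  assumes "normed_space_over scaleE" and "normed_space_over scaleF"
    and "open U" and "x \<in> U"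
  shows "(caratheodory_differentiable scaleE scaleF U f x \<longleftrightarrow>
            frechet_differentiable scaleE scaleF U f x) \<and>
         (\<forall>\<Phi>. slope_function scaleE scaleF U f x \<Phi> \<longrightarrow>
            has_frechet_derivative scaleE scaleF U f x (\<Phi> x)) \<and>
         (\<forall>A. has_frechet_derivative scaleE scaleF U f x A \<longrightarrow>
            (\<exists>\<Phi>. slope_function scaleE scaleF U f x \<Phi> \<and> \<Phi> x = A))"
proof -
  have 1: "has_frechet_derivative scaleE scaleF U f x (\<Phi> x)"
    if "slope_function scaleE scaleF U f x \<Phi>" for \<Phi>
    using slope_function_imp_frechet[OF that \<open>x \<in> U\<close>] .
  have 2: "\<exists>\<Phi>. slope_function scaleE scaleF U f x \<Phi> \<and> \<Phi> x = A"
    if "has_frechet_derivative scaleE scaleF U f x A" for A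
    using frechet_imp_slope_function[OF assms(1,2) that] by blast
  from 1 2 show ?thesis
    unfolding caratheodory_differentiable_def frechet_differentiable_def by blast
qed

end
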